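(* Let $\ell\ge 1$, and for $0\le i\le\ell$ let $\mathrm{C}_i$ be a nonsingular $sN_i\times sN_i$ matrix that is monolithic, $\mathrm{C}_i=\mathrm{X}_i\,\mathrm{diag}_{1\le j\le s}(C_{i,j})\,\mathrm{X}_i^{-1}$; for $1\le i\le\ell$ let $\mathrm{W}_i$ be a nonsingular $sN_i\times sN_i$ matrix that is monolithic, $\mathrm{W}_i=\mathrm{X}_i\,\mathrm{diag}_{1\le j\le s}(W_{i,j})\,\mathrm{X}_i^{-1}$. Let $\mathrm{T}_0,\dots,\mathrm{T}_\ell$ be the stage-coupled multigrid iteration matrices built from the $\mathrm{C}_i$ and $\mathrm{W}_i$, and for each $1\le j\le s$ let $T_{0,j},\dots,T_{\ell,j}$ be the multigrid iteration matrices of the $j$-th characteristic stage built from the $C_{i,j}$ and $W_{i,j}$ (both defined in the context). If for every $1\le j\le s$ the multigrid iteration for the $j$-th characteristic stage (iteration matrix $T_{\ell,j}$ for systems with matrix $C_{\ell,j}$) converges, then the stage-coupled multigrid iteration (iteration matrix $\mathrm{T}_\ell$ for systems with matrix $\mathrm{C}_\ell$) converges.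
   Context: $X\in\mathbb{C}^{s\times s}$ is an invertible matrix, namely the eigenvector matrix in $A=X\Lambda X^{-1}$, where the Butcher matrix $A\in\mathbb{R}^{s\times s}$ of an $s$-stage Runge-Kutta method is assumed diagonalizable. $V_h^0\subset V_h^1\subset\dots\subset V_h^\ell$ are nested finite-dimensional (finite element) spaces with bases, $N_i=\dim V_h^i$, and $\mathrm{X}_i=X\otimes I_{N_i}$ ($\otimes$ is the Kronecker product). For $1\le i\le\ell$, $P_i$ ($N_i\times N_{i-1}$) is the matrix of the inclusion $V_h^{i-1}\to V_h^i$ (prolongation) and $R_i$ ($N_{i-1}\times N_i$) is a restriction matrix; $\mathrm{P}_i=I_s\otimes P_i$, $\mathrm{R}_i=I_s\otimes R_i$. Definition (monolithic). An $sN_i\times sN_i$ matrix $\mathrm{Y}$ is monolithic (with respect to $\mathrm{X}_i$) if there are $N_i\times N_i$ complex matrices $Y_1,\dots,Y_s$ with $\mathrm{X}_i^{-1}\mathrm{Y}\mathrm{X}_i=\mathrm{diag}_{1\le j\le s}Y_j$ (block diagonal). Multigrid iteration matrices. Fix integers $\nu_1,\nu_2\ge 0$ (numbers of pre- and post-smoothing steps) and $\gamma\ge1$ (number of recursive calls). With $\mathrm{S}_i=\mathrm{I}-\mathrm{W}_i^{-1}\mathrm{C}_i$, the stage-coupled multigrid iteration matrices are $$\mathrm{T}_0=0,\qquad \mathrm{T}_i=\mathrm{S}_i^{\nu_2}\left(\mathrm{I}-\mathrm{P}_i\left(\mathrm{I}-\mathrm{T}_{i-1}^\gamma\right)\mathrm{C}_{i-1}^{-1}\mathrm{R}_i\mathrm{C}_i\right)\mathrm{S}_i^{\nu_1},\quad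 1\le i\le \ell.$$ With $S_{i,j}=I-W_{i,j}^{-1}C_{i,j}$, those of the $j$-th characteristic stage are $$T_{0,j}=0,\qquad T_{i,j}=S_{i,j}^{\nu_2}\left(I-P_i\left(I-T_{i-1,j}^\gamma\right)C_{i-1,j}^{-1}R_iC_{i,j}\right)S_{i,j}^{\nu_1},\quad 1\le i\le\ell.$$ Convergence. For a nonsingular matrix $C$, the iteration with iteration matrix $T$ for the system $Cx=b$ is $x^{(k+1)}=Tx^{(k)}+\tilde g$ with $\tilde g=(I-T)C^{-1}b$, so that the solution is a fixed point. It converges if for every right-hand side $b$ and every initial vector $x^{(0)}$ (complex vectors) the iterates tend to $C^{-1}b$. *)

theory Defs
  imports Complex_Main "Jordan_Normal_Form.Gauss_Jordan_Elimination"
begin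

definition kronecker_mat :: "'a :: times mat \<Rightarrow> 'a mat \<Rightarrow> 'a mat" where
  "kronecker_mat A B = mat (dim_row A * dim_row B) (dim_col A * dim_col B)
     (\<lambda>(i, j). A $$ (i div dim_row B, j div dim_col B) * B $$ (i mod dim_row B, j mod dim_col B))"

text \<open>The inverse of an invertible matrix; the value on other matrices is irrelevant.\<close>

definition minv :: "'a :: field mat \<Rightarrow> 'a mat" where
  "minv M = the (mat_inverse M)"

definition stage_mat :: "complex mat \<Rightarrow> nat \<Rightarrow> complex mat" where
  "stage_mat X n = kronecker_mat X (1\<^sub>m n)"

text \<open>Stages are numbered from 0 to \<open>s - 1\<close>.\<close>

definition stage_diag :: "nat \<Rightarrow> (nat \<Rightarrow> complex mat) \<Rightarrow> complex mat" where
  "stage_diag s Y = diag_block_mat (map Y [0..<s])"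

definition monolithic :: "complex mat \<Rightarrow> nat \<Rightarrow> complex mat \<Rightarrow> bool" where
  "monolithic X n M \<longleftrightarrow>
     M \<in> carrier_mat (dim_row X * n) (dim_row X * n) \<and>
     (\<exists>Y. (\<forall>j<dim_row X. Y j \<in> carrier_mat n n) \<and>
          minv (stage_mat X n) * M * stage_mat X n = stage_diag (dim_row X) Y)"

context vector_space
begin

definition indexed_basis :: "nat \<Rightarrow> (nat \<Rightarrow> 'b) \<Rightarrow> 'b set \<Rightarrow> bool" where
  "indexed_basis n \<phi> V \<longleftrightarrow>
     inj_on \<phi> {..<n} \<and> independent (\<phi> ` {..<n}) \<and> span (\<phi> ` {..<n}) = V"

text \<open>Matrix of the inclusion of the span of \<open>\<psi> 0, \<dots>, \<psi> (m - 1)\<close> into the span of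
  \<open>\<phi> 0, \<dots>, \<phi> (n - 1)\<close>: its column \<open>j\<close> holds the coordinates of \<open>\<psi> j\<close> in the basis \<open>\<phi>\<close>.\<close>

definition inclusion_mat :: "nat \<Rightarrow> (nat \<Rightarrow> 'b) \<Rightarrow> nat \<Rightarrow> (nat \<Rightarrow> 'b) \<Rightarrow> 'a mat" where
  "inclusion_mat n \<phi> m \<psi> = mat n m (\<lambda>(k, j). representation (\<phi> ` {..<n}) (\<psi> j) (\<phi> k))"

end

definition smoother_mat :: "complex mat \<Rightarrow> complex mat \<Rightarrow> complex mat" where
  "smoother_mat W C = 1\<^sub>m (dim_row C) - minv W * C"

text \<open>One recursion for both multigrid iterations: the stage-coupled one is obtained from the
  Kronecker-product transfer matrices, the one of a characteristic stage from the plain ones.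
  \<open>P (Suc i)\<close> and \<open>R (Suc i)\<close> are the transfer matrices between levels \<open>i\<close> and \<open>Suc i\<close>.\<close>

fun multigrid_mat ::
  "nat \<Rightarrow> nat \<Rightarrow> nat \<Rightarrow> (nat \<Rightarrow> complex mat) \<Rightarrow> (nat \<Rightarrow> complex mat) \<Rightarrow>
   (nat \<Rightarrow> complex mat) \<Rightarrow> (nat \<Rightarrow> complex mat) \<Rightarrow> nat \<Rightarrow> complex mat" where
  "multigrid_mat \<nu>1 \<nu>2 \<gamma> P R C W 0 = 0\<^sub>m (dim_row (C 0)) (dim_row (C 0))"
| "multigrid_mat \<nu>1 \<nu>2 \<gamma> P R C W (Suc i) =
     smoother_mat (W (Suc i)) (C (Suc i)) ^\<^sub>m \<nu>2 *
     (1\<^sub>m (dim_row (C (Suc i))) -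
        P (Suc i) * (1\<^sub>m (dim_row (C i)) - multigrid_mat \<nu>1 \<nu>2 \<gamma> P R C W i ^\<^sub>m \<gamma>) *
        minv (C i) * R (Suc i) * C (Suc i)) *
     smoother_mat (W (Suc i)) (C (Suc i)) ^\<^sub>m \<nu>1"

definition iteration_step :: "complex mat \<Rightarrow> complex mat \<Rightarrow> complex vec \<Rightarrow> complex vec \<Rightarrow> complex vec" where
  "iteration_step T C b x = T *\<^sub>v x + ((1\<^sub>m (dim_row C) - T) * minv C) *\<^sub>v b"

text \<open>Convergence in \<open>\<complex>\<^sup>n\<close> is expressed componentwise, as \<^typ>\<open>complex vec\<close> carries no topology.\<close>

definition iteration_converges :: "complex mat \<Rightarrow> complex mat \<Rightarrow> bool" where
  "iteration_converges T C \<longleftrightarrow>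
     (\<forall>b \<in> carrier_vec (dim_row C). \<forall>x0 \<in> carrier_vec (dim_row C). \<forall>i < dim_row C.
        (\<lambda>k. (iteration_step T C b ^^ k) x0 $ i) \<longlonglongrightarrow> (minv C *\<^sub>v b) $ i)"

end

theory Submission
  imports Defs "Jordan_Normal_Form.Determinant"
begin

text \<open>Write \<open>X\<^sub>n = X \<otimes> I\<^sub>n\<close>. The map sending a family of \<open>m \<times> n\<close> blocks to
  \<open>X\<^sub>m diag(Y\<^sub>j) X\<^sub>n\<^sup>-\<^sup>1\<close> respects sums, products and inverses, and it sends the constant family \<open>P\<close>
  to \<open>I\<^sub>s \<otimes> P\<close>, because \<open>(X \<otimes> I\<^sub>m) (I\<^sub>s \<otimes> P) = X \<otimes> P = (I\<^sub>s \<otimes> P) (X \<otimes> I\<^sub>n)\<close>. Hence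
  the stage-coupled recursion is the image of the recursions of the characteristic stages, and
  \<open>T\<^sub>l\<close> is similar to \<open>diag(T\<^sub>l\<^sub>,\<^sub>j)\<close>. Convergence for all data means that the powers of the
  iteration matrix tend to zero entrywise, which passes from the blocks to \<open>T\<^sub>l\<close>.\<close>

section \<open>Inverse matrices\<close>

text \<open>\<open>minv\<close> unfolds to \<open>the (mat_inverse A)\<close>, so the point is that
  Gauss-Jordan elimination succeeds: an invertible matrix is a unit of the ring of square matrices,
  which excludes the result \<open>None\<close>.\<close>

lemma minv_inverse:
  fixes A :: "'a :: field mat"
  assumes A: "A \<in> carrier_mat n n" and inv: "invertible_mat A"
  shows "minv A \<in> carrier_mat n n" and "A * minv A = 1\<^sub>m n" and "minv A * A = 1\<^sub>m n"
proof -
  obtain B where AB: "A * B = 1\<^sub>m (dim_row A)" and BA: "B * A = 1\<^sub>m (dim_row B)"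
    using inv unfolding invertible_mat_def inverts_mat_def by auto
  \<comment> \<open>\<open>invertible_mat\<close> does not fix the shape of the witness
    \<open>B\<close>; comparing the column counts in the two product equations does.\<close>
  have "dim_col B = n" using arg_cong[OF AB, of dim_col] A by simp
  moreover have rB: "dim_row B = n" using arg_cong[OF BA, of dim_col] A by simp
  ultimately have "B \<in> carrier_mat n n" by auto
  then have "A \<in> Units (ring_mat TYPE('a) n ())"
    using A AB BA rB by (auto simp: Units_def ring_mat_simps)
  then obtain D where D: "mat_inverse A = Some D"
    using mat_inverse(1)[OF A, of "()"] by (cases "mat_inverse A") auto
  show "minv A \<in> carrier_mat n n" "A * minv A = 1\<^sub>m n" "minv A * A = 1\<^sub>m n"
    using mat_inverse(2)[OF A D] D by (auto simp: minv_def)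
qed

text \<open>For square matrices over a field a right inverse is also a left inverse, so one product
  equation suffices.\<close>

lemma invertible_matI:
  fixes A :: "'a :: field mat"
  assumes A: "A \<in> carrier_mat n n" and B: "B \<in> carrier_mat n n" and AB: "A * B = 1\<^sub>m n"
  shows "invertible_mat A"
  using mat_mult_left_right_inverse[OF A B AB] assms
  unfolding invertible_mat_def inverts_mat_def by auto

lemma minv_eqI:
  fixes A :: "'a :: field mat"
  assumes A: "A \<in> carrier_mat n n" and B: "B \<in> carrier_mat n n" and AB: "A * B = 1\<^sub>m n"
  shows "minv A = B"
proof -
  note inv = minv_inverse[OF A invertible_matI[OF A B AB]]
  have "minv A = minv A * (A * B)" using inv(1) AB by simp
  also have "\<dots> = minv A * A * B" using inv(1) A B by (simp add: assoc_mult_mat)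
  also have "\<dots> = B" using inv(3) B by simp
  finally show ?thesis .
qed

text \<open>The determinant form of invertibility is what later passes from a block diagonal matrix
  to each of its blocks.\<close>

lemma invertible_mat_iff_det_nonzero:
  fixes A :: "'a :: field mat"
  assumes A: "A \<in> carrier_mat n n"
  shows "invertible_mat A \<longleftrightarrow> det A \<noteq> 0"
proof
  assume "invertible_mat A"
  note inv = minv_inverse[OF A this]
  have "det A * det (minv A) = 1" using det_mult[OF A inv(1)] inv(2) by simp
  then show "det A \<noteq> 0" by auto
next
  assume "det A \<noteq> 0"
  from det_non_zero_imp_unit[OF A this, of "()"]
  show "invertible_mat A" using invertible_matI[OF A]
    by (auto simp: Units_def ring_mat_simps)
qed

section \<open>Kronecker products and block diagonal matrices\<close>

lemma kronecker_mat_carrier [intro]: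
  "A \<in> carrier_mat a b \<Longrightarrow> B \<in> carrier_mat n m \<Longrightarrow> kronecker_mat A B \<in> carrier_mat (a * n) (b * m)"
  unfolding kronecker_mat_def by auto

text \<open>Grouping the indices into consecutive runs of length \<open>b\<close> makes the quotient
  constant on each run while the remainder covers all values below \<open>b\<close>. This splits the
  combined index of a Kronecker product into two.\<close>

lemma sum_div_mod:
  fixes f :: "nat \<Rightarrow> nat \<Rightarrow> 'a :: comm_monoid_add"
  shows "(\<Sum>k<a * b. f (k div b) (k mod b)) = (\<Sum>i<a. \<Sum>j<b. f i j)"
proof -
  have "(\<Sum>k<a * b. f (k div b) (k mod b)) = (\<Sum>i<a. \<Sum>k = i * b..<i * b + b. f (k div b) (k mod b))"
    by (rule sum.nat_group[symmetric])
  also have "\<dots> = (\<Sum>i<a. \<Sum>j<b. f i j)"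
  proof (rule sum.cong[OF refl])
    fix i
    have "(\<Sum>k = i * b..<i * b + b. f (k div b) (k mod b))
        = (\<Sum>j = 0..<b. f ((j + i * b) div b) ((j + i * b) mod b))"
      using sum.shift_bounds_nat_ivl[of "\<lambda>k. f (k div b) (k mod b)" 0 "i * b" b]
      by (simp add: add.commute)
    also have "\<dots> = (\<Sum>j<b. f i j)"
      by (rule sum.cong) auto
    finally show "(\<Sum>k = i * b..<i * b + b. f (k div b) (k mod b)) = (\<Sum>j<b. f i j)" .
  qed
  finally show ?thesis .
qed

text \<open>The mixed-product rule: the inner sum over the combined index becomes a double sum, and
  commutativity of the entries separates it into a product of two sums.\<close>

lemma kronecker_mat_mult:
  fixes A B :: "'a :: comm_semiring_0 mat"
  assumes A: "A \<in> carrier_mat a b" and D: "D \<in> carrier_mat b c"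
    and B: "B \<in> carrier_mat n m" and E: "E \<in> carrier_mat m k"
  shows "kronecker_mat A B * kronecker_mat D E = kronecker_mat (A * D) (B * E)"
proof (rule eq_matI)
  fix i j assume "i < dim_row (kronecker_mat (A * D) (B * E))" "j < dim_col (kronecker_mat (A * D) (B * E))"
  then have i: "i < a * n" and j: "j < c * k"
    using assms by (auto simp: kronecker_mat_def)
  \<comment> \<open>The index bounds exclude empty blocks, so remainders modulo \<open>n\<close> and
    \<open>k\<close> are valid indices.\<close>
  then have n: "0 < n" "0 < k" by (auto intro: gr0I)
  have "(kronecker_mat A B * kronecker_mat D E) $$ (i, j) =
      (\<Sum>q<b * m. (A $$ (i div n, q div m) * B $$ (i mod n, q mod m)) *
                  (D $$ (q div m, j div k) * E $$ (q mod m, j mod k)))"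
    using assms i j by (simp add: kronecker_mat_def scalar_prod_def atLeast0LessThan)
  also have "\<dots> = (\<Sum>p<b. \<Sum>q<m. (A $$ (i div n, p) * B $$ (i mod n, q)) *
                  (D $$ (p, j div k) * E $$ (q, j mod k)))"
    by (rule sum_div_mod)
  also have "\<dots> = (\<Sum>p<b. A $$ (i div n, p) * D $$ (p, j div k)) *
                  (\<Sum>q<m. B $$ (i mod n, q) * E $$ (q, j mod k))"
    unfolding sum_product by (intro sum.cong refl) (simp add: ac_simps)
  also have "\<dots> = kronecker_mat (A * D) (B * E) $$ (i, j)"
    using assms i j n
    by (simp add: kronecker_mat_def scalar_prod_def atLeast0LessThan less_mult_imp_div_less)
  finally show "(kronecker_mat A B * kronecker_mat D E) $$ (i, j) = kronecker_mat (A * D) (B * E) $$ (i, j)" .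
qed (use assms in \<open>auto simp: kronecker_mat_def\<close>)

lemma kronecker_mat_one: "kronecker_mat (1\<^sub>m a) (1\<^sub>m n) = (1\<^sub>m (a * n) :: 'a :: semiring_1 mat)"
proof (rule eq_matI)
  fix i j assume "i < dim_row (1\<^sub>m (a * n) :: 'a mat)" "j < dim_col (1\<^sub>m (a * n) :: 'a mat)"
  then have ij: "i < a * n" "j < a * n" by auto
  then have "0 < n" by (auto intro: gr0I)
  moreover have "i = j \<longleftrightarrow> i div n = j div n \<and> i mod n = j mod n"
    by (metis div_mult_mod_eq)
  ultimately show "kronecker_mat (1\<^sub>m a) (1\<^sub>m n) $$ (i, j) = (1\<^sub>m (a * n) :: 'a mat) $$ (i, j)"
    using ij by (auto simp: kronecker_mat_def less_mult_imp_div_less)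
qed (auto simp: kronecker_mat_def)

section \<open>Algebra, determinants and entries of block diagonal matrices\<close>

lemma stage_diag_0: "stage_diag 0 Y = 0\<^sub>m 0 0"
  unfolding stage_diag_def by simp

text \<open>Blocks may be rectangular because prolongations and restrictions have to be covered as
  well.\<close>

lemma stage_diag_carrier:
  "(\<And>j. j < s \<Longrightarrow> Y j \<in> carrier_mat n m) \<Longrightarrow> stage_diag s Y \<in> carrier_mat (s * n) (s * m)"
proof (rule carrier_matI)
  assume Y: "\<And>j. j < s \<Longrightarrow> Y j \<in> carrier_mat n m"
  have "map (dim_row \<circ> Y) [0..<s] = replicate s n" "map (dim_col \<circ> Y) [0..<s] = replicate s m"
    using carrier_matD[OF Y] by (auto intro!: nth_equalityI)
  then show "dim_row (stage_diag s Y) = s * n" "dim_col (stage_diag s Y) = s * m"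
    by (simp_all add: stage_diag_def dim_diag_block_mat sum_list_replicate)
qed

text \<open>\<open>diag_block_mat\<close> recurses on the head of its list, so block 0 is peeled off
  and the remaining family is shifted. The inductions that peel blocks of a varying family therefore
  generalise over that family.\<close>

lemma stage_diag_Suc:
  assumes Y: "\<And>j. j < Suc s \<Longrightarrow> Y j \<in> carrier_mat n m"
  shows "stage_diag (Suc s) Y =
    four_block_mat (Y 0) (0\<^sub>m n (s * m)) (0\<^sub>m (s * n) m) (stage_diag s (\<lambda>j. Y (Suc j)))"
proof -
  have "map Y [0..<Suc s] = Y 0 # map (\<lambda>j. Y (Suc j)) [0..<s]"
    by (simp add: map_upt_Suc del: upt_Suc)
  then show ?thesis
    using carrier_matD[OF Y[of 0]] carrier_matD[OF stage_diag_carrier[of s "\<lambda>j. Y (Suc j)" n m]] Y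
    by (simp add: stage_diag_def Let_def del: upt_Suc)
qed

lemma stage_diag_cong: "(\<And>j. j < s \<Longrightarrow> Y j = Z j) \<Longrightarrow> stage_diag s Y = stage_diag s Z"
  unfolding stage_diag_def by (intro arg_cong[of _ _ diag_block_mat]) simp

lemma stage_diag_mult:
  fixes Y Z :: "nat \<Rightarrow> complex mat"
  assumes "\<And>j. j < s \<Longrightarrow> Y j \<in> carrier_mat n m" and "\<And>j. j < s \<Longrightarrow> Z j \<in> carrier_mat m k"
  shows "stage_diag s Y * stage_diag s Z = stage_diag s (\<lambda>j. Y j * Z j)"
  using assms
proof (induction s arbitrary: Y Z)
  case 0
  then show ?case by (simp add: stage_diag_0)
next
  case (Suc s)
  have Y0: "Y 0 \<in> carrier_mat n m" and Z0: "Z 0 \<in> carrier_mat m k" using Suc.prems by auto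
  have DY: "stage_diag s (\<lambda>j. Y (Suc j)) \<in> carrier_mat (s * n) (s * m)"
    and DZ: "stage_diag s (\<lambda>j. Z (Suc j)) \<in> carrier_mat (s * m) (s * k)"
    using Suc.prems by (auto intro!: stage_diag_carrier)
  have DYZ: "stage_diag s (\<lambda>j. Y (Suc j) * Z (Suc j)) \<in> carrier_mat (s * n) (s * k)"
    using Suc.prems by (auto intro!: stage_diag_carrier mult_carrier_mat)
  have "stage_diag (Suc s) (\<lambda>j. Y j * Z j) =
     four_block_mat (Y 0 * Z 0) (0\<^sub>m n (s * k)) (0\<^sub>m (s * n) k) (stage_diag s (\<lambda>j. Y (Suc j) * Z (Suc j)))"
    using Suc.prems by (intro stage_diag_Suc) (auto intro!: mult_carrier_mat)
  moreover have "stage_diag s (\<lambda>j. Y (Suc j)) * stage_diag s (\<lambda>j. Z (Suc j)) = stage_diag s (\<lambda>j. Y (Suc j) * Z (Suc j))"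
    using Suc.prems by (intro Suc.IH) auto
  moreover have "stage_diag (Suc s) Y = four_block_mat (Y 0) (0\<^sub>m n (s * m)) (0\<^sub>m (s * n) m) (stage_diag s (\<lambda>j. Y (Suc j)))"
    using Suc.prems by (intro stage_diag_Suc) auto
  moreover have "stage_diag (Suc s) Z = four_block_mat (Z 0) (0\<^sub>m m (s * k)) (0\<^sub>m (s * m) k) (stage_diag s (\<lambda>j. Z (Suc j)))"
    using Suc.prems by (intro stage_diag_Suc) auto
  ultimately show ?case
    using Y0 Z0 DY DZ DYZ mult_carrier_mat[OF Y0 Z0]
      mult_four_block_mat[OF Y0 zero_carrier_mat zero_carrier_mat DY Z0 zero_carrier_mat zero_carrier_mat DZ]
    by (simp add: left_mult_zero_mat right_mult_zero_mat)
qed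

lemma stage_diag_minus:
  fixes Y Z :: "nat \<Rightarrow> complex mat"
  assumes "\<And>j. j < s \<Longrightarrow> Y j \<in> carrier_mat n m" and "\<And>j. j < s \<Longrightarrow> Z j \<in> carrier_mat n m"
  shows "stage_diag s Y - stage_diag s Z = stage_diag s (\<lambda>j. Y j - Z j)"
  using assms
proof (induction s arbitrary: Y Z)
  case 0
  then show ?case by (simp add: stage_diag_0)
next
  case (Suc s)
  have [simp]: "dim_row (Y 0) = n" "dim_row (Z 0) = n" "dim_col (Y 0) = m" "dim_col (Z 0) = m"
    using Suc.prems(1)[of 0] Suc.prems(2)[of 0] by auto
  have "stage_diag s (\<lambda>j. Y (Suc j)) \<in> carrier_mat (s * n) (s * m)"
    and "stage_diag s (\<lambda>j. Z (Suc j)) \<in> carrier_mat (s * n) (s * m)"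
    using Suc.prems by (auto intro!: stage_diag_carrier)
  then have [simp]: "dim_row (stage_diag s (\<lambda>j. Y (Suc j))) = s * n" "dim_col (stage_diag s (\<lambda>j. Y (Suc j))) = s * m"
    "dim_row (stage_diag s (\<lambda>j. Z (Suc j))) = s * n" "dim_col (stage_diag s (\<lambda>j. Z (Suc j))) = s * m"
    by auto
  have YZ: "stage_diag (Suc s) (\<lambda>j. Y j - Z j) =
     four_block_mat (Y 0 - Z 0) (0\<^sub>m n (s * m)) (0\<^sub>m (s * n) m) (stage_diag s (\<lambda>j. Y (Suc j) - Z (Suc j)))"
    using Suc.prems by (intro stage_diag_Suc) (auto intro!: minus_carrier_mat)
  have IH: "stage_diag s (\<lambda>j. Y (Suc j)) - stage_diag s (\<lambda>j. Z (Suc j)) = stage_diag s (\<lambda>j. Y (Suc j) - Z (Suc j))"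
    using Suc.prems by (intro Suc.IH) auto
  have Y: "stage_diag (Suc s) Y = four_block_mat (Y 0) (0\<^sub>m n (s * m)) (0\<^sub>m (s * n) m) (stage_diag s (\<lambda>j. Y (Suc j)))"
    using Suc.prems by (intro stage_diag_Suc) auto
  have Z: "stage_diag (Suc s) Z = four_block_mat (Z 0) (0\<^sub>m n (s * m)) (0\<^sub>m (s * n) m) (stage_diag s (\<lambda>j. Z (Suc j)))"
    using Suc.prems by (intro stage_diag_Suc) auto
  show ?case
    unfolding Y Z YZ IH[symmetric] by (intro eq_matI) auto
qed

lemma stage_diag_one: "stage_diag s (\<lambda>j. 1\<^sub>m n) = 1\<^sub>m (s * n)"
proof (induction s)
  case 0
  \<comment> \<open>The zero and the identity matrix of size 0 agree, having no entries.\<close>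
  show ?case by (intro eq_matI) (auto simp: stage_diag_0)
next
  case (Suc s)
  then show ?case by (simp add: stage_diag_Suc[where n = n and m = n])
qed

lemma stage_diag_zero: "stage_diag s (\<lambda>j. 0\<^sub>m n m) = 0\<^sub>m (s * n) (s * m)"
  by (induction s) (simp_all add: stage_diag_0 stage_diag_Suc[where n = n and m = m])

lemma stage_diag_pow:
  assumes Y: "\<And>j. j < s \<Longrightarrow> Y j \<in> carrier_mat n n"
  shows "stage_diag s Y ^\<^sub>m k = stage_diag s (\<lambda>j. Y j ^\<^sub>m k)"
proof (induction k)
  case 0
  \<comment> \<open>The zeroth power is the identity of size \<open>dim_row (Y j)\<close>, which is
    known to be \<open>n\<close> only for \<open>j < s\<close>; hence the congruence rule.\<close>
  have "stage_diag s (\<lambda>j. Y j ^\<^sub>m 0) = stage_diag s (\<lambda>j. 1\<^sub>m n)"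
    using Y by (intro stage_diag_cong) auto
  then show ?case using stage_diag_carrier[of s Y n n, OF Y] by (simp add: stage_diag_one)
next
  case (Suc k)
  then show ?case using Y by (simp add: stage_diag_mult[where n = n and m = n and k = n])
qed

text \<open>Each peeling step gives a block triangular matrix, whose determinant is the product of
  the determinants of its two diagonal blocks.\<close>

lemma det_stage_diag:
  assumes "\<And>j. j < s \<Longrightarrow> Y j \<in> carrier_mat n n"
  shows "det (stage_diag s Y) = (\<Prod>j<s. det (Y j))"
  using assms
proof (induction s arbitrary: Y)
  case 0
  then show ?case by (simp add: stage_diag_0)
next
  case (Suc s)
  have "stage_diag (Suc s) Y = four_block_mat (Y 0) (0\<^sub>m n (s * n)) (0\<^sub>m (s * n) n) (stage_diag s (\<lambda>j. Y (Suc j)))"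
    using Suc.prems by (rule stage_diag_Suc)
  then have "det (stage_diag (Suc s) Y) = det (Y 0) * det (stage_diag s (\<lambda>j. Y (Suc j)))"
    using Suc.prems
    by (simp only:, intro det_four_block_mat_lower_left_zero[where n = n and m = "s * n"]) (auto intro!: stage_diag_carrier)
  then show ?case
    using Suc.prems by (subst (asm) Suc.IH) (auto simp: prod.lessThan_Suc_shift simp del: prod.lessThan_Suc)
qed

text \<open>This puts block diagonal matrices into the quotient and remainder indexing of
  \<open>kronecker_mat\<close>. It serves both for identifying constant families with Kronecker
  products and for taking limits entry by entry.\<close>

lemma stage_diag_index:
  assumes "\<And>j. j < s \<Longrightarrow> Y j \<in> carrier_mat n m" and "i < s * n" and "j < s * m"
  shows "stage_diag s Y $$ (i, j) = (if i div n = j div m then Y (i div n) $$ (i mod n, j mod m) else 0)"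
  using assms
proof (induction s arbitrary: Y i j)
  case 0
  then show ?case by simp
next
  case (Suc s)
  have n: "0 < n" and m: "0 < m" using Suc.prems(2,3) by (auto intro: gr0I)
  have Y0: "Y 0 \<in> carrier_mat n m" using Suc.prems by auto
  have D: "stage_diag s (\<lambda>j. Y (Suc j)) \<in> carrier_mat (s * n) (s * m)"
    using Suc.prems by (auto intro!: stage_diag_carrier)
  have eq: "stage_diag (Suc s) Y $$ (i, j) =
      (if i < n then if j < m then Y 0 $$ (i, j) else 0
       else if j < m then 0 else stage_diag s (\<lambda>j. Y (Suc j)) $$ (i - n, j - m))"
    using carrier_matD[OF Y0] carrier_matD[OF D] Suc.prems by (subst stage_diag_Suc[where n = n and m = m]) auto
  \<comment> \<open>Removing the first block lowers both quotients by one and keeps both remainders.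
    If just one index lies in the first block, the quotients differ and the entry is an off-diagonal
    zero.\<close>
  have i: "i div n = (if i < n then 0 else Suc ((i - n) div n))" "i mod n = (if i < n then i else (i - n) mod n)"
    using n by (auto simp: le_div_geq le_mod_geq)
  have j: "j div m = (if j < m then 0 else Suc ((j - m) div m))" "j mod m = (if j < m then j else (j - m) mod m)"
    using m by (auto simp: le_div_geq le_mod_geq)
  have IH: "stage_diag s (\<lambda>j. Y (Suc j)) $$ (i - n, j - m) =
     (if (i - n) div n = (j - m) div m then Y (Suc ((i - n) div n)) $$ ((i - n) mod n, (j - m) mod m) else 0)"
    if "n \<le> i" "m \<le> j"
    using Suc.prems that by (intro Suc.IH) auto
  show ?case unfolding eq i j using IH by auto
qed

text \<open>The identity factor contributes 1 exactly when the two quotients agree, which is the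
  case distinction in \<open>stage_diag_index\<close>.\<close>

lemma kronecker_one_eq_stage_diag:
  assumes M: "M \<in> carrier_mat n m"
  shows "kronecker_mat (1\<^sub>m s) M = stage_diag s (\<lambda>j. M)"
proof (rule eq_matI)
  have D: "stage_diag s (\<lambda>j. M) \<in> carrier_mat (s * n) (s * m)"
    using M by (intro stage_diag_carrier) auto
  fix i j assume "i < dim_row (stage_diag s (\<lambda>j. M))" "j < dim_col (stage_diag s (\<lambda>j. M))"
  then have ij: "i < s * n" "j < s * m" using D by auto
  then show "kronecker_mat (1\<^sub>m s) M $$ (i, j) = stage_diag s (\<lambda>j. M) $$ (i, j)"
    using M stage_diag_index[of s "\<lambda>j. M" n m i j]
    by (auto simp: kronecker_mat_def less_mult_imp_div_less)
qed (use M stage_diag_carrier[of s "\<lambda>j. M" n m] in \<open>auto simp: kronecker_mat_def\<close>)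

section \<open>Convergence and powers of the iteration matrix\<close>

text \<open>The exact solution is a fixed point of the step, so the error
  \<open>x - minv C *\<^sub>v b\<close> is multiplied by \<open>T\<close> each time.\<close>

lemma iteration_step_funpow:
  assumes T: "T \<in> carrier_mat n n" and C: "C \<in> carrier_mat n n" and inv: "invertible_mat C"
    and b: "b \<in> carrier_vec n" and x: "x \<in> carrier_vec n"
  shows "(iteration_step T C b ^^ k) x = T ^\<^sub>m k *\<^sub>v (x - minv C *\<^sub>v b) + minv C *\<^sub>v b"
  using x
proof (induction k arbitrary: x)
  case 0
  have y: "minv C *\<^sub>v b \<in> carrier_vec n" using minv_inverse(1)[OF C inv] b by auto
  moreover have "x = x - minv C *\<^sub>v b + minv C *\<^sub>v b"
    using 0 carrier_matD[OF minv_inverse(1)[OF C inv]] b by (intro eq_vecI) auto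
  ultimately show ?case using T 0 by auto
next
  case (Suc k)
  define y where "y = minv C *\<^sub>v b"
  have y: "y \<in> carrier_vec n" using minv_inverse(1)[OF C inv] b by (auto simp: y_def)
  have Tk: "T ^\<^sub>m k \<in> carrier_mat n n" using T by simp
  have Ty: "T *\<^sub>v y \<in> carrier_vec n" "T *\<^sub>v x \<in> carrier_vec n" "T *\<^sub>v (x - y) \<in> carrier_vec n"
    using T y Suc.prems by auto
  \<comment> \<open>The inhomogeneous term of a step, expressed through the solution
    \<open>y\<close>.\<close>
  have "((1\<^sub>m n - T) * minv C) *\<^sub>v b = (1\<^sub>m n - T) *\<^sub>v y"
    unfolding y_def using T minv_inverse(1)[OF C inv] b by (intro assoc_mult_mat_vec[where ?n\<^sub>1.0 = n]) auto
  also have "\<dots> = y - T *\<^sub>v y"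
    using T y by (simp add: minus_mult_distrib_mat_vec[where nr = n and nc = n])
  finally have "iteration_step T C b x = T *\<^sub>v x + (y - T *\<^sub>v y)"
    using C by (simp add: iteration_step_def)
  also have "\<dots> = T *\<^sub>v (x - y) + y"
    using T y Suc.prems Ty by (auto simp: mult_minus_distrib_mat_vec[where nr = n and nc = n])
  finally have step: "iteration_step T C b x = T *\<^sub>v (x - y) + y" .
  \<comment> \<open>The first step is split off, not the last, so the induction hypothesis is used
    at the new starting vector; this is why \<open>x\<close> is arbitrary.\<close>
  have "(iteration_step T C b ^^ Suc k) x = (iteration_step T C b ^^ k) (T *\<^sub>v (x - y) + y)"
    by (simp add: funpow_swap1 step)
  also have "\<dots> = T ^\<^sub>m k *\<^sub>v (T *\<^sub>v (x - y) + y - y) + y"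
    unfolding y_def by (rule Suc.IH) (use Ty y in \<open>auto simp: y_def\<close>)
  also have "T *\<^sub>v (x - y) + y - y = T *\<^sub>v (x - y)"
    using carrier_vecD[OF Ty(3)] carrier_vecD[OF y] carrier_matD[OF T] by (intro eq_vecI) auto
  also have "T ^\<^sub>m k *\<^sub>v (T *\<^sub>v (x - y)) = T ^\<^sub>m Suc k *\<^sub>v (x - y)"
    using T Tk y Suc.prems by (simp add: assoc_mult_mat_vec[where ?n\<^sub>1.0 = n and ?n\<^sub>2.0 = n and ?n\<^sub>3.0 = n])
  finally show ?case by (simp add: y_def)
qed

text \<open>By the error formula, each component of an iterate is a finite linear combination of
  entries of \<open>T ^\<^sub>m k\<close> plus a component of the solution. Conversely, suitable
  data isolate a single entry of the power.\<close>

lemma iteration_converges_iff: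
  assumes T: "T \<in> carrier_mat n n" and C: "C \<in> carrier_mat n n" and inv: "invertible_mat C"
  shows "iteration_converges T C \<longleftrightarrow> (\<forall>i<n. \<forall>j<n. (\<lambda>k. (T ^\<^sub>m k) $$ (i, j)) \<longlonglongrightarrow> 0)"
proof (intro iffI allI impI)
  fix i j assume conv: "iteration_converges T C" and ij: "i < n" "j < n"
  have zero: "minv C *\<^sub>v 0\<^sub>v n = 0\<^sub>v n"
    using minv_inverse(1)[OF C inv] by (intro eq_vecI) auto
  \<comment> \<open>With right-hand side zero the solution is zero, and starting at the unit vector
    \<open>j\<close> the iterates are the columns \<open>j\<close> of the powers.\<close>
  have "(\<lambda>k. (iteration_step T C (0\<^sub>v n) ^^ k) (unit_vec n j) $ i) \<longlonglongrightarrow> (minv C *\<^sub>v 0\<^sub>v n) $ i"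
    using conv C ij unfolding iteration_converges_def by auto
  moreover have "(iteration_step T C (0\<^sub>v n) ^^ k) (unit_vec n j) $ i = (T ^\<^sub>m k) $$ (i, j)" for k
  proof -
    have "T ^\<^sub>m k \<in> carrier_mat n n" using T by simp
    moreover have "unit_vec n j - 0\<^sub>v n = (unit_vec n j :: complex vec)" by (intro eq_vecI) auto
    ultimately show ?thesis
      using iteration_step_funpow[OF T C inv, of "0\<^sub>v n" "unit_vec n j" k] zero ij T
      by (simp add: scalar_prod_right_unit[where n = n])
  qed
  ultimately show "(\<lambda>k. (T ^\<^sub>m k) $$ (i, j)) \<longlonglongrightarrow> 0" using zero ij by simp
next
  assume lim: "\<forall>i<n. \<forall>j<n. (\<lambda>k. (T ^\<^sub>m k) $$ (i, j)) \<longlonglongrightarrow> 0"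
  show "iteration_converges T C"
    unfolding iteration_converges_def
  proof (intro ballI allI impI)
    fix b x :: "complex vec" and i assume "b \<in> carrier_vec (dim_row C)" "x \<in> carrier_vec (dim_row C)" "i < dim_row C"
    then have b: "b \<in> carrier_vec n" and x: "x \<in> carrier_vec n" and i: "i < n" using C by auto
    define y where "y = minv C *\<^sub>v b"
    have y: "y \<in> carrier_vec n" using minv_inverse(1)[OF C inv] b by (auto simp: y_def)
    have "(iteration_step T C b ^^ k) x $ i = (\<Sum>j<n. (T ^\<^sub>m k) $$ (i, j) * (x - y) $ j) + y $ i" for k
    proof -
      have "T ^\<^sub>m k \<in> carrier_mat n n" using T by simp
      from carrier_matD[OF this] show ?thesis
        using iteration_step_funpow[OF T C inv b x, of k] carrier_vecD[OF x] carrier_vecD[OF y] carrier_matD[OF T] i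
        unfolding y_def[symmetric]
        by (simp add: scalar_prod_def atLeast0LessThan)
    qed
    moreover have "(\<lambda>k. (\<Sum>j<n. (T ^\<^sub>m k) $$ (i, j) * (x - y) $ j) + y $ i) \<longlonglongrightarrow> (\<Sum>j<n. 0 * (x - y) $ j) + y $ i"
      using lim i by (intro tendsto_intros) auto
    ultimately show "(\<lambda>k. (iteration_step T C b ^^ k) x $ i) \<longlonglongrightarrow> (minv C *\<^sub>v b) $ i"
      by (simp add: y_def)
  qed
qed

section \<open>Monolithic matrices\<close>

locale eigenvector_matrix =
  fixes X :: "complex mat" and s :: nat
  assumes X: "X \<in> carrier_mat s s" and X_inv: "invertible_mat X"
begin

text \<open>Two sizes are needed because transfer matrices act between levels. For
  \<open>m = n\<close> this is a similarity transformation, and its values are the monolithic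
  matrices.\<close>

definition stage_conj :: "nat \<Rightarrow> nat \<Rightarrow> (nat \<Rightarrow> complex mat) \<Rightarrow> complex mat" where
  "stage_conj m n Y = stage_mat X m * stage_diag s Y * minv (stage_mat X n)"

lemma stage_mat_carrier: "stage_mat X n \<in> carrier_mat (s * n) (s * n)"
  unfolding stage_mat_def using X by auto

lemma stage_mat_invertible: "invertible_mat (stage_mat X n)"
proof (rule invertible_matI[OF stage_mat_carrier])
  \<comment> \<open>The inverse is guessed as the Kronecker product of \<open>minv X\<close> with
    the identity; the mixed-product rule confirms it.\<close>
  show "kronecker_mat (minv X) (1\<^sub>m n) \<in> carrier_mat (s * n) (s * n)"
    using minv_inverse(1)[OF X X_inv] by auto
  show "stage_mat X n * kronecker_mat (minv X) (1\<^sub>m n) = 1\<^sub>m (s * n)"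
    unfolding stage_mat_def
    using minv_inverse[OF X X_inv] kronecker_mat_mult[OF X _ one_carrier_mat one_carrier_mat, of "minv X" s n]
    by (simp add: kronecker_mat_one)
qed

lemmas stage_mat_inverse = minv_inverse[OF stage_mat_carrier stage_mat_invertible]

lemma stage_conj_carrier:
  "(\<And>j. j < s \<Longrightarrow> Y j \<in> carrier_mat m n) \<Longrightarrow> stage_conj m n Y \<in> carrier_mat (s * m) (s * n)"
  unfolding stage_conj_def using stage_mat_carrier[of m] stage_mat_inverse(1)[of n] stage_diag_carrier[of s Y m n]
  by (auto intro!: mult_carrier_mat)

lemma stage_conj_cong: "(\<And>j. j < s \<Longrightarrow> Y j = Z j) \<Longrightarrow> stage_conj m n Y = stage_conj m n Z"
  unfolding stage_conj_def using stage_diag_cong[of s Y Z] by simp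

text \<open>The inverse of \<open>stage_mat X n\<close> ending the first factor cancels against the
  \<open>stage_mat X n\<close> beginning the second, provided the middle sizes agree. The
  calculation is otherwise reassociation.\<close>

lemma stage_conj_mult:
  assumes "\<And>j. j < s \<Longrightarrow> Y j \<in> carrier_mat m n" and "\<And>j. j < s \<Longrightarrow> Z j \<in> carrier_mat n k"
  shows "stage_conj m n Y * stage_conj n k Z = stage_conj m k (\<lambda>j. Y j * Z j)"
proof -
  define A Q Qi B K where defs: "A = stage_mat X m" "Q = stage_mat X n" "Qi = minv (stage_mat X n)"
    "B = stage_diag s Y" "K = stage_diag s Z"
  define Ri where "Ri = minv (stage_mat X k)"
  have c [simp]: "A \<in> carrier_mat (s * m) (s * m)" "Q \<in> carrier_mat (s * n) (s * n)"
    "Qi \<in> carrier_mat (s * n) (s * n)" "B \<in> carrier_mat (s * m) (s * n)" "K \<in> carrier_mat (s * n) (s * k)"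
    "Ri \<in> carrier_mat (s * k) (s * k)"
    unfolding defs Ri_def using assms
    by (auto intro!: stage_mat_carrier stage_mat_inverse stage_diag_carrier)
  have "A * B * Qi * (Q * K * Ri) = A * B * (Qi * (Q * K * Ri))"
    by (rule assoc_mult_mat) (auto intro!: mult_carrier_mat c)
  also have "Qi * (Q * K * Ri) = Qi * (Q * (K * Ri))"
    by (subst assoc_mult_mat[OF c(2,5,6)]) simp
  also have "\<dots> = Qi * Q * (K * Ri)"
    by (rule assoc_mult_mat[symmetric]) (auto intro!: mult_carrier_mat c)
  also have "Qi * Q = 1\<^sub>m (s * n)" unfolding defs by (rule stage_mat_inverse)
  also have "1\<^sub>m (s * n) * (K * Ri) = K * Ri"
    by (rule left_mult_one_mat) (auto intro!: mult_carrier_mat c)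
  also have "A * B * (K * Ri) = A * B * K * Ri"
    by (rule assoc_mult_mat[symmetric]) (auto intro!: mult_carrier_mat c)
  also have "A * B * K = A * (B * K)"
    by (rule assoc_mult_mat) (auto intro!: mult_carrier_mat c)
  also have "B * K = stage_diag s (\<lambda>j. Y j * Z j)"
    unfolding defs using assms by (rule stage_diag_mult)
  finally show ?thesis unfolding stage_conj_def defs Ri_def .
qed

lemma stage_conj_minus:
  assumes "\<And>j. j < s \<Longrightarrow> Y j \<in> carrier_mat m n" and "\<And>j. j < s \<Longrightarrow> Z j \<in> carrier_mat m n"
  shows "stage_conj m n Y - stage_conj m n Z = stage_conj m n (\<lambda>j. Y j - Z j)"
proof -
  have c: "stage_diag s Y \<in> carrier_mat (s * m) (s * n)" "stage_diag s Z \<in> carrier_mat (s * m) (s * n)"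
    using assms by (auto intro!: stage_diag_carrier)
  show ?thesis
    unfolding stage_conj_def
    using c stage_mat_carrier[of m] stage_mat_inverse(1)[of n] assms
    by (simp add: stage_diag_minus[where n = m and m = n, symmetric] mult_minus_distrib_mat[OF stage_mat_carrier[of m] c]
        minus_mult_distrib_mat[where nr = "s * m" and n = "s * n" and nc = "s * n"])
qed

lemma stage_conj_one: "stage_conj n n (\<lambda>j. 1\<^sub>m n) = 1\<^sub>m (s * n)"
  unfolding stage_conj_def stage_diag_one using stage_mat_carrier[of n] stage_mat_inverse[of n] by simp

lemma stage_conj_zero: "stage_conj m n (\<lambda>j. 0\<^sub>m m n) = 0\<^sub>m (s * m) (s * n)"
  unfolding stage_conj_def stage_diag_zero using stage_mat_carrier[of m] stage_mat_inverse(1)[of n]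
  by (simp add: right_mult_zero_mat left_mult_zero_mat)

lemma stage_conj_pow:
  assumes Y: "\<And>j. j < s \<Longrightarrow> Y j \<in> carrier_mat n n"
  shows "stage_conj n n Y ^\<^sub>m k = stage_conj n n (\<lambda>j. Y j ^\<^sub>m k)"
proof (induction k)
  case 0
  have "stage_conj n n (\<lambda>j. Y j ^\<^sub>m 0) = 1\<^sub>m (s * n)"
    unfolding stage_conj_one[symmetric] using Y by (intro stage_conj_cong) auto
  then show ?case using stage_conj_carrier[of Y n n] Y by simp
next
  case (Suc k)
  then show ?case using Y by (simp add: stage_conj_mult)
qed

text \<open>Moving \<open>stage_mat X\<close> across \<open>kronecker_mat (1\<^sub>m s) M\<close>
  only changes its size from \<open>m\<close> to \<open>n\<close>, after which it meets its inverse.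
  Through this the coupled transfer matrices become images of constant families.\<close>

lemma stage_conj_const:
  assumes M: "M \<in> carrier_mat m n"
  shows "stage_conj m n (\<lambda>j. M) = kronecker_mat (1\<^sub>m s) M"
proof -
  have K: "kronecker_mat (1\<^sub>m s) M \<in> carrier_mat (s * m) (s * n)" using M by auto
  have "stage_mat X m * kronecker_mat (1\<^sub>m s) M = kronecker_mat (1\<^sub>m s) M * stage_mat X n"
    unfolding stage_mat_def using X M
    by (simp add: kronecker_mat_mult[OF X one_carrier_mat one_carrier_mat M]
        kronecker_mat_mult[OF one_carrier_mat X M one_carrier_mat])
  then have "stage_conj m n (\<lambda>j. M) = kronecker_mat (1\<^sub>m s) M * stage_mat X n * minv (stage_mat X n)"
    unfolding stage_conj_def using M by (simp add: kronecker_one_eq_stage_diag)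
  also have "\<dots> = kronecker_mat (1\<^sub>m s) M"
    using assoc_mult_mat[OF K stage_mat_carrier[of n] stage_mat_inverse(1)[of n]] K
    by (simp add: stage_mat_inverse)
  finally show ?thesis .
qed

section \<open>Determinants, inverses and limits of conjugated block families\<close>

lemma stage_conj_det:
  assumes Y: "\<And>j. j < s \<Longrightarrow> Y j \<in> carrier_mat n n"
  shows "det (stage_conj n n Y) = (\<Prod>j<s. det (Y j))"
proof -
  have "det (stage_mat X n) * det (minv (stage_mat X n)) = 1"
    using det_mult[OF stage_mat_carrier stage_mat_inverse(1), of n] stage_mat_inverse(2)[of n] by simp
  moreover have "det (stage_conj n n Y) = det (stage_mat X n) * det (stage_diag s Y) * det (minv (stage_mat X n))"
    unfolding stage_conj_def
    using stage_mat_carrier[of n] stage_mat_inverse(1)[of n] stage_diag_carrier[of s Y n n] Y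
    by (simp add: det_mult[where n = "s * n"])
  ultimately have "det (stage_conj n n Y) = det (stage_diag s Y)" by (simp add: mult.commute mult.left_commute)
  then show ?thesis using det_stage_diag[of s Y n] Y by simp
qed

text \<open>A nonzero product of determinants has only nonzero factors. Thus nonsingularity of the
  characteristic stages follows from that of the coupled matrices.\<close>

lemma stage_conj_invertibleD:
  assumes Y: "\<And>j. j < s \<Longrightarrow> Y j \<in> carrier_mat n n" and inv: "invertible_mat (stage_conj n n Y)" and j: "j < s"
  shows "invertible_mat (Y j)"
proof -
  have "det (stage_conj n n Y) \<noteq> 0" using invertible_mat_iff_det_nonzero[OF stage_conj_carrier[of Y n n]] Y inv by auto
  then have "det (Y j) \<noteq> 0" using Y j by (auto simp: stage_conj_det)
  then show ?thesis using invertible_mat_iff_det_nonzero[OF Y[OF j]] by auto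
qed

text \<open>The blockwise inverses exist by the preceding lemma, and their image is a right inverse,
  hence the inverse.\<close>

lemma stage_conj_minv:
  assumes Y: "\<And>j. j < s \<Longrightarrow> Y j \<in> carrier_mat n n" and inv: "invertible_mat (stage_conj n n Y)"
  shows "minv (stage_conj n n Y) = stage_conj n n (\<lambda>j. minv (Y j))"
proof (rule minv_eqI)
  have Yinv: "minv (Y j) \<in> carrier_mat n n" "Y j * minv (Y j) = 1\<^sub>m n" if "j < s" for j
    using minv_inverse[OF Y[OF that] stage_conj_invertibleD[of Y n, OF Y inv that]] by auto
  show "stage_conj n n Y \<in> carrier_mat (s * n) (s * n)" using Y by (rule stage_conj_carrier)
  show "stage_conj n n (\<lambda>j. minv (Y j)) \<in> carrier_mat (s * n) (s * n)" using Yinv by (intro stage_conj_carrier) auto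
  have "stage_conj n n Y * stage_conj n n (\<lambda>j. minv (Y j)) = stage_conj n n (\<lambda>j. Y j * minv (Y j))"
    using Y Yinv by (intro stage_conj_mult) auto
  also have "\<dots> = 1\<^sub>m (s * n)"
    unfolding stage_conj_one[symmetric] using Yinv by (intro stage_conj_cong) auto
  finally show "stage_conj n n Y * stage_conj n n (\<lambda>j. minv (Y j)) = 1\<^sub>m (s * n)" .
qed

text \<open>The two outer factors do not depend on \<open>k\<close>, so each entry is a fixed finite
  linear combination of entries of the block diagonal matrices.\<close>

lemma stage_conj_tendsto_zero:
  assumes Y: "\<And>k j. j < s \<Longrightarrow> Y k j \<in> carrier_mat n n"
    and lim: "\<And>j p q. j < s \<Longrightarrow> p < n \<Longrightarrow> q < n \<Longrightarrow> (\<lambda>k. Y k j $$ (p, q)) \<longlonglongrightarrow> 0"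
    and "p < s * n" and "q < s * n"
  shows "(\<lambda>k. stage_conj n n (Y k) $$ (p, q)) \<longlonglongrightarrow> 0"
proof -
  define A B where "A = stage_mat X n" and "B = minv (stage_mat X n)"
  have A: "A \<in> carrier_mat (s * n) (s * n)" and B: "B \<in> carrier_mat (s * n) (s * n)"
    unfolding A_def B_def by (auto intro!: stage_mat_carrier stage_mat_inverse)
  have D: "stage_diag s (Y k) \<in> carrier_mat (s * n) (s * n)" for k
    using Y by (intro stage_diag_carrier) auto
  have limD: "(\<lambda>k. stage_diag s (Y k) $$ (i, j)) \<longlonglongrightarrow> 0" if "i < s * n" "j < s * n" for i j
  proof -
    have "0 < n" using that by (auto intro: gr0I)
    \<comment> \<open>Entries outside the diagonal blocks are constantly zero; the others converge
      by hypothesis.\<close>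
    then show ?thesis
      using that Y lim[of "i div n" "i mod n" "j mod n"]
      by (cases "i div n = j div n") (auto simp: stage_diag_index[where n = n and m = n] less_mult_imp_div_less)
  qed
  have "stage_conj n n (Y k) $$ (p, q) =
      (\<Sum>j<s * n. (\<Sum>i<s * n. A $$ (p, i) * stage_diag s (Y k) $$ (i, j)) * B $$ (j, q))" for k
    using D[of k] A B assms(3,4) unfolding stage_conj_def B_def[symmetric] unfolding A_def[symmetric]
    by (simp del: assoc_mult_mat add: scalar_prod_def atLeast0LessThan)
  moreover have "(\<lambda>k. \<Sum>j<s * n. (\<Sum>i<s * n. A $$ (p, i) * stage_diag s (Y k) $$ (i, j)) * B $$ (j, q))
      \<longlonglongrightarrow> (\<Sum>j<s * n. (\<Sum>i<s * n. A $$ (p, i) * 0) * B $$ (j, q))"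
    using limD by (intro tendsto_intros) auto
  ultimately show ?thesis by simp
qed

end

section \<open>Multigrid iteration matrices\<close>

lemma smoother_mat_carrier:
  assumes "C \<in> carrier_mat n n" and "W \<in> carrier_mat n n" and "invertible_mat W"
  shows "smoother_mat W C \<in> carrier_mat n n"
  using minv_inverse(1)[OF assms(2,3)] assms(1)
  by (auto simp: smoother_mat_def intro!: minus_carrier_mat mult_carrier_mat)

text \<open>On a positive level the left smoother power fixes the row count and the right one the
  column count, so a case distinction replaces induction.\<close>

lemma multigrid_mat_carrier:
  assumes C: "\<And>i. i \<le> l \<Longrightarrow> C i \<in> carrier_mat (N i) (N i)"
    and W: "\<And>i. 1 \<le> i \<Longrightarrow> i \<le> l \<Longrightarrow> W i \<in> carrier_mat (N i) (N i)"
    and W_inv: "\<And>i. 1 \<le> i \<Longrightarrow> i \<le> l \<Longrightarrow> invertible_mat (W i)"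
    and "i \<le> l"
  shows "multigrid_mat \<nu>1 \<nu>2 \<gamma> P R C W i \<in> carrier_mat (N i) (N i)"
proof (cases i)
  case 0
  then show ?thesis using C[of 0] by auto
next
  case (Suc k)
  then have "smoother_mat (W (Suc k)) (C (Suc k)) \<in> carrier_mat (N (Suc k)) (N (Suc k))"
    using C W W_inv \<open>i \<le> l\<close> by (intro smoother_mat_carrier) auto
  from carrier_matD[OF this] show ?thesis
    unfolding Suc using carrier_matD[OF C[of "Suc k"]] \<open>i \<le> l\<close> Suc by (intro carrier_matI) simp_all
qed

section \<open>Blockwise form of the smoothers and of the multigrid recursion\<close>

context eigenvector_matrix
begin

lemma smoother_mat_stage_conj:
  assumes C: "\<And>j. j < s \<Longrightarrow> C j \<in> carrier_mat n n" and W: "\<And>j. j < s \<Longrightarrow> W j \<in> carrier_mat n n"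
    and inv: "invertible_mat (stage_conj n n W)"
  shows "smoother_mat (stage_conj n n W) (stage_conj n n C) = stage_conj n n (\<lambda>j. smoother_mat (W j) (C j))"
proof -
  have Wi: "minv (W j) \<in> carrier_mat n n" if "j < s" for j
    using minv_inverse(1)[OF W stage_conj_invertibleD[of W n, OF W inv]] that by auto
  have "smoother_mat (stage_conj n n W) (stage_conj n n C)
      = stage_conj n n (\<lambda>j. 1\<^sub>m n) - stage_conj n n (\<lambda>j. minv (W j)) * stage_conj n n C"
    using stage_conj_carrier[of C n n] C W inv
    by (simp add: smoother_mat_def stage_conj_one stage_conj_minv)
  also have "\<dots> = stage_conj n n (\<lambda>j. 1\<^sub>m n) - stage_conj n n (\<lambda>j. minv (W j) * C j)"
    using Wi C by (simp add: stage_conj_mult)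
  also have "\<dots> = stage_conj n n (\<lambda>j. 1\<^sub>m n - minv (W j) * C j)"
    using Wi C by (intro stage_conj_minus) (auto intro!: mult_carrier_mat)
  also have "\<dots> = stage_conj n n (\<lambda>j. smoother_mat (W j) (C j))"
    using C by (intro stage_conj_cong) (auto simp: smoother_mat_def)
  finally show ?thesis .
qed

text \<open>Both recursions have the same shape, and every matrix in the coupled one is a
  \<open>stage_conj\<close> image. Induction on the level pulls \<open>stage_conj\<close> outwards
  through all operations.\<close>

lemma multigrid_mat_stage_conj:
  assumes Cj: "\<And>i j. i \<le> l \<Longrightarrow> j < s \<Longrightarrow> Cj i j \<in> carrier_mat (N i) (N i)"
    and C: "\<And>i. i \<le> l \<Longrightarrow> C i = stage_conj (N i) (N i) (Cj i)"
    and C_inv: "\<And>i. i \<le> l \<Longrightarrow> invertible_mat (C i)"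
    and Wj: "\<And>i j. 1 \<le> i \<Longrightarrow> i \<le> l \<Longrightarrow> j < s \<Longrightarrow> Wj i j \<in> carrier_mat (N i) (N i)"
    and W: "\<And>i. 1 \<le> i \<Longrightarrow> i \<le> l \<Longrightarrow> W i = stage_conj (N i) (N i) (Wj i)"
    and W_inv: "\<And>i. 1 \<le> i \<Longrightarrow> i \<le> l \<Longrightarrow> invertible_mat (W i)"
    and P: "\<And>i. 1 \<le> i \<Longrightarrow> i \<le> l \<Longrightarrow> P i \<in> carrier_mat (N i) (N (i - 1))"
    and R: "\<And>i. 1 \<le> i \<Longrightarrow> i \<le> l \<Longrightarrow> R i \<in> carrier_mat (N (i - 1)) (N i)"
    and "i \<le> l"
  shows "multigrid_mat \<nu>1 \<nu>2 \<gamma> (\<lambda>i. kronecker_mat (1\<^sub>m s) (P i)) (\<lambda>i. kronecker_mat (1\<^sub>m s) (R i)) C W i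
    = stage_conj (N i) (N i) (\<lambda>j. multigrid_mat \<nu>1 \<nu>2 \<gamma> P R (\<lambda>i. Cj i j) (\<lambda>i. Wj i j) i)"
  using \<open>i \<le> l\<close>
proof (induction i)
  case 0
  have "stage_conj (N 0) (N 0) (\<lambda>j. multigrid_mat \<nu>1 \<nu>2 \<gamma> P R (\<lambda>i. Cj i j) (\<lambda>i. Wj i j) 0)
      = stage_conj (N 0) (N 0) (\<lambda>j. 0\<^sub>m (N 0) (N 0))"
    using carrier_matD[OF Cj[of 0]] by (intro stage_conj_cong) auto
  then show ?case
    using C[of 0] carrier_matD[OF stage_conj_carrier[of "Cj 0" "N 0" "N 0"]] Cj[of 0] by (simp add: stage_conj_zero)
next
  case (Suc i)
  let ?m = "N i" and ?n = "N (Suc i)"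
  let ?S = "\<lambda>j. smoother_mat (Wj (Suc i) j) (Cj (Suc i) j)"
  let ?T = "\<lambda>j. multigrid_mat \<nu>1 \<nu>2 \<gamma> P R (\<lambda>i. Cj i j) (\<lambda>i. Wj i j) i"
  let ?E = "\<lambda>j. 1\<^sub>m ?m - ?T j ^\<^sub>m \<gamma>"
  let ?D = "\<lambda>j. minv (Cj i j)"
  let ?Ca = "\<lambda>j. P (Suc i) * ?E j * ?D j * R (Suc i) * Cj (Suc i) j"
  have i: "i \<le> l" "Suc i \<le> l" "1 \<le> Suc i" using Suc.prems by auto
  have Wj_inv: "invertible_mat (Wj k j)" if "1 \<le> k" "k \<le> l" "j < s" for k j
    using stage_conj_invertibleD[of "Wj k" "N k" j] Wj W W_inv that by auto
  have Cj_inv: "invertible_mat (Cj i j)" if "j < s" for j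
    using stage_conj_invertibleD[of "Cj i" "N i" j] Cj C C_inv i that by auto
  have cC: "Cj i j \<in> carrier_mat ?m ?m" "Cj (Suc i) j \<in> carrier_mat ?n ?n" if "j < s" for j
    using Cj i that by auto
  have cW: "Wj (Suc i) j \<in> carrier_mat ?n ?n" if "j < s" for j
    using Wj i that by auto
  have cS: "?S j \<in> carrier_mat ?n ?n" if "j < s" for j
    using cC[OF that] cW[OF that] Wj_inv[OF i(3,2) that] by (intro smoother_mat_carrier)
  have cT: "?T j \<in> carrier_mat ?m ?m" if "j < s" for j
    using Cj Wj Wj_inv i that by (intro multigrid_mat_carrier[where l = l and N = N]) auto
  have cD: "?D j \<in> carrier_mat ?m ?m" if "j < s" for j
    using minv_inverse(1)[OF cC(1)[OF that] Cj_inv[OF that]] .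
  have cE: "?E j \<in> carrier_mat ?m ?m" if "j < s" for j
    using cT[OF that] by (intro minus_carrier_mat pow_carrier_mat)
  have cP: "P (Suc i) \<in> carrier_mat ?n ?m" and cR: "R (Suc i) \<in> carrier_mat ?m ?n"
    using P[OF i(3,2)] R[OF i(3,2)] by auto
  have cPE: "P (Suc i) * ?E j \<in> carrier_mat ?n ?m" if "j < s" for j
    using mult_carrier_mat[OF cP cE[OF that]] .
  have cPED: "P (Suc i) * ?E j * ?D j \<in> carrier_mat ?n ?m" if "j < s" for j
    using mult_carrier_mat[OF cPE[OF that] cD[OF that]] .
  have cPEDR: "P (Suc i) * ?E j * ?D j * R (Suc i) \<in> carrier_mat ?n ?n" if "j < s" for j
    using mult_carrier_mat[OF cPED[OF that] cR] .
  have S: "smoother_mat (W (Suc i)) (C (Suc i)) = stage_conj ?n ?n ?S"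
    using W[OF i(3,2)] W_inv[OF i(3,2)] C[OF i(2)] cC cW
    by (simp add: smoother_mat_stage_conj)
  have E: "1\<^sub>m (s * ?m) - stage_conj ?m ?m ?T ^\<^sub>m \<gamma> = stage_conj ?m ?m ?E"
    using cT by (simp add: stage_conj_pow stage_conj_minus flip: stage_conj_one)
  have D: "minv (C i) = stage_conj ?m ?m ?D"
    using C[OF i(1)] C_inv[OF i(1)] cC(1) by (simp add: stage_conj_minv)
  have dims: "dim_row (C (Suc i)) = s * ?n" "dim_row (C i) = s * ?m"
    using C[OF i(2)] C[OF i(1)] stage_conj_carrier[of "Cj i" ?m ?m] stage_conj_carrier[of "Cj (Suc i)" ?n ?n] cC
    by auto
  \<comment> \<open>The coarse-grid correction passes from the fine size through the coarse one and
    back, so the factors are merged from the left with the sizes changing at the transfer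
    matrices.\<close>
  have "kronecker_mat (1\<^sub>m s) (P (Suc i)) * stage_conj ?m ?m ?E * minv (C i)
        * kronecker_mat (1\<^sub>m s) (R (Suc i)) * C (Suc i) = stage_conj ?n ?n ?Ca"
  proof -
    have "stage_conj ?n ?m (\<lambda>j. P (Suc i)) * stage_conj ?m ?m ?E = stage_conj ?n ?m (\<lambda>j. P (Suc i) * ?E j)"
      using cP cE by (intro stage_conj_mult)
    moreover have "stage_conj ?n ?m (\<lambda>j. P (Suc i) * ?E j) * stage_conj ?m ?m ?D
        = stage_conj ?n ?m (\<lambda>j. P (Suc i) * ?E j * ?D j)"
      using cPE cD by (intro stage_conj_mult)
    moreover have "stage_conj ?n ?m (\<lambda>j. P (Suc i) * ?E j * ?D j) * stage_conj ?m ?n (\<lambda>j. R (Suc i))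
        = stage_conj ?n ?n (\<lambda>j. P (Suc i) * ?E j * ?D j * R (Suc i))"
      using cPED cR by (intro stage_conj_mult)
    moreover have "stage_conj ?n ?n (\<lambda>j. P (Suc i) * ?E j * ?D j * R (Suc i)) * stage_conj ?n ?n (Cj (Suc i))
        = stage_conj ?n ?n ?Ca"
      using cPEDR cC(2) by (intro stage_conj_mult)
    ultimately show ?thesis
      by (simp only: D C[OF i(2)] stage_conj_const[OF cP, symmetric] stage_conj_const[OF cR, symmetric])
  qed
  moreover have cCa: "?Ca j \<in> carrier_mat ?n ?n" if "j < s" for j
    using mult_carrier_mat[OF cPEDR[OF that] cC(2)[OF that]] .
  ultimately have "multigrid_mat \<nu>1 \<nu>2 \<gamma> (\<lambda>i. kronecker_mat (1\<^sub>m s) (P i)) (\<lambda>i. kronecker_mat (1\<^sub>m s) (R i)) C W (Suc i)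
      = stage_conj ?n ?n ?S ^\<^sub>m \<nu>2 * (stage_conj ?n ?n (\<lambda>j. 1\<^sub>m ?n) - stage_conj ?n ?n ?Ca) * stage_conj ?n ?n ?S ^\<^sub>m \<nu>1"
    using Suc.IH[OF i(1)] by (simp add: dims S E stage_conj_one)
  also have "\<dots> = stage_conj ?n ?n (\<lambda>j. ?S j ^\<^sub>m \<nu>2 * (1\<^sub>m ?n - ?Ca j) * ?S j ^\<^sub>m \<nu>1)"
  proof -
    have cA: "?S j ^\<^sub>m \<nu>2 * (1\<^sub>m ?n - ?Ca j) \<in> carrier_mat ?n ?n" if "j < s" for j
      using mult_carrier_mat[OF pow_carrier_mat[OF cS[OF that]] minus_carrier_mat[OF cCa[OF that]]] .
    have "stage_conj ?n ?n ?S ^\<^sub>m k = stage_conj ?n ?n (\<lambda>j. ?S j ^\<^sub>m k)" for k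
      using cS by (rule stage_conj_pow)
    moreover have "stage_conj ?n ?n (\<lambda>j. 1\<^sub>m ?n) - stage_conj ?n ?n ?Ca = stage_conj ?n ?n (\<lambda>j. 1\<^sub>m ?n - ?Ca j)"
      using cCa by (intro stage_conj_minus one_carrier_mat)
    moreover have "stage_conj ?n ?n (\<lambda>j. ?S j ^\<^sub>m \<nu>2) * stage_conj ?n ?n (\<lambda>j. 1\<^sub>m ?n - ?Ca j)
        = stage_conj ?n ?n (\<lambda>j. ?S j ^\<^sub>m \<nu>2 * (1\<^sub>m ?n - ?Ca j))"
      using cS cCa by (intro stage_conj_mult pow_carrier_mat minus_carrier_mat)
    moreover have "stage_conj ?n ?n (\<lambda>j. ?S j ^\<^sub>m \<nu>2 * (1\<^sub>m ?n - ?Ca j)) * stage_conj ?n ?n (\<lambda>j. ?S j ^\<^sub>m \<nu>1)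
        = stage_conj ?n ?n (\<lambda>j. ?S j ^\<^sub>m \<nu>2 * (1\<^sub>m ?n - ?Ca j) * ?S j ^\<^sub>m \<nu>1)"
      using cA cS by (intro stage_conj_mult pow_carrier_mat)
    ultimately show ?thesis by (simp only:)
  qed
  \<comment> \<open>The recursion takes the sizes of its identity matrices from
    \<open>dim_row\<close> of the stage matrices, which are known for \<open>j < s\<close>;
    congruence restricts to these stages.\<close>
  also have "\<dots> = stage_conj ?n ?n (\<lambda>j. multigrid_mat \<nu>1 \<nu>2 \<gamma> P R (\<lambda>i. Cj i j) (\<lambda>i. Wj i j) (Suc i))"
    using carrier_matD[OF cC(1)] carrier_matD[OF cC(2)] by (intro stage_conj_cong) simp
  finally show ?case .
qed

end


theorem theorem4p2:
  fixes s l \<nu>1 \<nu>2 \<gamma> :: nat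
    and A :: "real mat" and X \<Lambda> :: "complex mat"
    and scale :: "'k :: field \<Rightarrow> 'v :: ab_group_add \<Rightarrow> 'v" and emb :: "'k \<Rightarrow> complex"
    and V :: "nat \<Rightarrow> 'v set" and N :: "nat \<Rightarrow> nat" and \<phi> :: "nat \<Rightarrow> nat \<Rightarrow> 'v"
    and P R :: "nat \<Rightarrow> complex mat"
    and C W :: "nat \<Rightarrow> complex mat"
    and Cj Wj :: "nat \<Rightarrow> nat \<Rightarrow> complex mat"
  assumes "A \<in> carrier_mat s s" and "X \<in> carrier_mat s s" and "\<Lambda> \<in> carrier_mat s s"
    and "invertible_mat X" and "diagonal_mat \<Lambda>"
    and "map_mat complex_of_real A = X * \<Lambda> * minv X"
    and "vector_space scale" and "field_hom emb"
    and "\<And>i. i \<le> l \<Longrightarrow> vector_space.indexed_basis scale (N i) (\<phi> i) (V i)"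
    and "\<And>i. 1 \<le> i \<Longrightarrow> i \<le> l \<Longrightarrow> V (i - 1) \<subseteq> V i"
    and "\<And>i. 1 \<le> i \<Longrightarrow> i \<le> l \<Longrightarrow>
           P i = map_mat emb (vector_space.inclusion_mat scale (N i) (\<phi> i) (N (i - 1)) (\<phi> (i - 1)))"
    and "\<And>i. 1 \<le> i \<Longrightarrow> i \<le> l \<Longrightarrow> R i \<in> carrier_mat (N (i - 1)) (N i)"
    and "\<gamma> \<ge> 1" and "l \<ge> 1"
    and "\<And>i. i \<le> l \<Longrightarrow> C i \<in> carrier_mat (s * N i) (s * N i)"
    and "\<And>i. i \<le> l \<Longrightarrow> invertible_mat (C i)"
    and "\<And>i. i \<le> l \<Longrightarrow> monolithic X (N i) (C i)"
    and "\<And>i j. i \<le> l \<Longrightarrow> j < s \<Longrightarrow> Cj i j \<in> carrier_mat (N i) (N i)"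
    and "\<And>i. i \<le> l \<Longrightarrow> C i = stage_mat X (N i) * stage_diag s (Cj i) * minv (stage_mat X (N i))"
    and "\<And>i. 1 \<le> i \<Longrightarrow> i \<le> l \<Longrightarrow> W i \<in> carrier_mat (s * N i) (s * N i)"
    and "\<And>i. 1 \<le> i \<Longrightarrow> i \<le> l \<Longrightarrow> invertible_mat (W i)"
    and "\<And>i. 1 \<le> i \<Longrightarrow> i \<le> l \<Longrightarrow> monolithic X (N i) (W i)"
    and "\<And>i j. 1 \<le> i \<Longrightarrow> i \<le> l \<Longrightarrow> j < s \<Longrightarrow> Wj i j \<in> carrier_mat (N i) (N i)"
    and "\<And>i. 1 \<le> i \<Longrightarrow> i \<le> l \<Longrightarrow>
           W i = stage_mat X (N i) * stage_diag s (Wj i) * minv (stage_mat X (N i))"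
    and "\<And>j. j < s \<Longrightarrow>
           iteration_converges
             (multigrid_mat \<nu>1 \<nu>2 \<gamma> P R (\<lambda>i. Cj i j) (\<lambda>i. Wj i j) l) (Cj l j)"
  shows "iteration_converges
           (multigrid_mat \<nu>1 \<nu>2 \<gamma>
              (\<lambda>i. kronecker_mat (1\<^sub>m s) (P i)) (\<lambda>i. kronecker_mat (1\<^sub>m s) (R i)) C W l) (C l)"
proof -
  interpret eigenvector_matrix X s
    using assms(2,4) by unfold_locales
  note Cj = assms(18)
  have C: "C i = stage_conj (N i) (N i) (Cj i)" if "i \<le> l" for i
    using assms(19)[OF that] by (simp add: stage_conj_def)
  have W: "W i = stage_conj (N i) (N i) (Wj i)" if "1 \<le> i" "i \<le> l" for i
    using assms(24)[OF that] by (simp add: stage_conj_def)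
  have P: "P i \<in> carrier_mat (N i) (N (i - 1))" if "1 \<le> i" "i \<le> l" for i
    using assms(11)[OF that] by (simp add: vector_space.inclusion_mat_def[OF assms(7)])
  let ?T = "\<lambda>j. multigrid_mat \<nu>1 \<nu>2 \<gamma> P R (\<lambda>i. Cj i j) (\<lambda>i. Wj i j) l"
  \<comment> \<open>Each stage system must be nonsingular before the power criterion can be applied
    to it.\<close>
  have Cj_inv: "invertible_mat (Cj l j)" if "j < s" for j
    using stage_conj_invertibleD[of "Cj l" "N l" j] Cj C assms(16) that by auto
  have Wj_inv: "invertible_mat (Wj i j)" if "1 \<le> i" "i \<le> l" "j < s" for i j
    using stage_conj_invertibleD[of "Wj i" "N i" j] W assms(21,23) that by auto
  have T: "?T j \<in> carrier_mat (N l) (N l)" if "j < s" for j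
    using Cj assms(23) Wj_inv that by (intro multigrid_mat_carrier[where l = l and N = N]) auto
  have lim: "(\<lambda>k. (?T j ^\<^sub>m k) $$ (p, q)) \<longlonglongrightarrow> 0" if "j < s" "p < N l" "q < N l" for j p q
    using iteration_converges_iff[OF T[OF that(1)] Cj[OF order_refl that(1)] Cj_inv[OF that(1)]]
      assms(25)[OF that(1)] that by auto
  have "(\<lambda>k. (stage_conj (N l) (N l) ?T ^\<^sub>m k) $$ (p, q)) \<longlonglongrightarrow> 0" if "p < s * N l" "q < s * N l" for p q
  proof -
    have "stage_conj (N l) (N l) ?T ^\<^sub>m k = stage_conj (N l) (N l) (\<lambda>j. ?T j ^\<^sub>m k)" for k
      using T by (rule stage_conj_pow)
    then show ?thesis
      using T lim that
        stage_conj_tendsto_zero[of "\<lambda>k j. ?T j ^\<^sub>m k" "N l" p q]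
      by simp
  qed
  \<comment> \<open>The power criterion is now read in the other direction, for the coupled system;
    it remains to identify the image of the stage iteration matrices with the coupled one.\<close>
  then have "iteration_converges (stage_conj (N l) (N l) ?T) (C l)"
    using iteration_converges_iff[OF stage_conj_carrier assms(15)[OF order_refl] assms(16)[OF order_refl], of ?T] T
    by auto
  then show ?thesis
    using multigrid_mat_stage_conj[of l Cj N C Wj W P R l \<nu>1 \<nu>2 \<gamma>] Cj C W P assms(12,16,21,23)
    by simp
qed

end
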